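(* Let $(G_j)_{j\in\mathbb Z}$ be a generalized Fibonacci sequence and let $e=G_0^2-G_1^2+G_0G_1$. If $n$ and $t$ are integers, then $$\sum_{j=1}^n G_{j+t}^6=\frac{G_{n+t}^5G_{n+t+3}-G_t^5G_{t+3}}{4}+\frac{e^2\bigl(G_{n+t}(G_{n+t+1}+G_{n+t-1})-G_t(G_{t+1}+G_{t-1})\bigr)}{4}.$$
   Context: A generalized Fibonacci sequence $(G_j)_{j\in\mathbb Z}$ is a sequence with arbitrary initial numbers $G_0,G_1$ (say complex; usually integers), not both zero, satisfying $G_j=G_{j-1}+G_{j-2}$ for $j\ge 2$, and extended to negative indices by $G_{-j}=G_{-(j-2)}-G_{-(j-1)}$ for $j\ge1$, so that the recurrence holds for all integer indices. For $n=0$ the sum $\sum_{j=1}^n a_j$ is $0$, and for $n<0$ it is understood as $\sum_{j=1}^n a_j=-\sum_{j=n+1}^{0}a_j$. *)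

theory Defs
  imports Complex_Main
begin

text \<open>
  The two recurrence clauses together amount to \<open>G j = G (j - 1) + G (j - 2)\<close> for every
  integer \<open>j\<close>; the second one covers \<open>j \<le> 1\<close>.
\<close>
definition gen_fibonacci :: "(int \<Rightarrow> complex) \<Rightarrow> bool" where
  "gen_fibonacci G \<longleftrightarrow>
     \<not> (G 0 = 0 \<and> G 1 = 0) \<and>
     (\<forall>j\<ge>2. G j = G (j - 1) + G (j - 2)) \<and>
     (\<forall>j\<ge>1. G (- j) = G (- (j - 2)) - G (- (j - 1)))"

text \<open>
  The sum of \<open>a j\<close> for \<open>j\<close> from \<open>1\<close> to an arbitrary integer \<open>n\<close>. The set sum over \<open>{1..n}\<close>
  alone would be \<open>0\<close> for every negative \<open>n\<close>.
\<close>
definition sum_from_1 :: "(int \<Rightarrow> complex) \<Rightarrow> int \<Rightarrow> complex" where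
  "sum_from_1 a n = (if n \<ge> 0 then (\<Sum>j=1..n. a j) else - (\<Sum>j=n+1..0. a j))"

end

theory Submission
  imports Defs
begin

text \<open>
  The right-hand side is a telescoped sum. Put
  \<open>F k = (G k ^ 5 * G (k + 3) + e\<^sup>2 * G k * (G (k + 1) + G (k - 1))) / 4\<close>; the claim is that the sum
  equals \<open>F (n + t) - F t\<close>, so everything rests on \<open>F k - F (k - 1) = G k ^ 6\<close>.

  With \<open>a = G (k - 1)\<close> and \<open>b = G k\<close>, the recurrence turns every term of \<open>F k\<close> and \<open>F (k - 1)\<close> into a
  polynomial in \<open>a\<close> and \<open>b\<close>. The constant \<open>e\<close> joins them because, up to sign, the quadratic form
  \<open>a\<^sup>2 - b\<^sup>2 + a * b\<close> is the same at every pair of consecutive terms (the Cassini identity), so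
  \<open>e\<^sup>2 = (a\<^sup>2 - b\<^sup>2 + a * b)\<^sup>2\<close>. The step is then the polynomial identity
  \<open>b ^ 5 * (2 * a + 3 * b) - a ^ 5 * (a + 2 * b) + (a\<^sup>2 - b\<^sup>2 + a * b)\<^sup>2 * (a\<^sup>2 + b\<^sup>2) = 4 * b ^ 6\<close>.
\<close>

lemma gen_fibonacci_rec:
  assumes "gen_fibonacci G"
  shows "G (k + 2) = G (k + 1) + G k"
proof (cases "k \<ge> 0")
  case True
  have "\<forall>j\<ge>2. G j = G (j - 1) + G (j - 2)"
    using assms by (simp add: gen_fibonacci_def)
  from this[rule_format, of "k + 2"] True show ?thesis
    by (simp add: algebra_simps)
next
  case False
  have "\<forall>j\<ge>1. G (- j) = G (- (j - 2)) - G (- (j - 1))"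
    using assms by (simp add: gen_fibonacci_def)
  from this[rule_format, of "- k"] False show ?thesis
    by (simp add: algebra_simps)
qed

text \<open>
  One step of the recurrence replaces the pair \<open>(a, b)\<close> by \<open>(b, a + b)\<close>, which negates the form
  \<open>a\<^sup>2 - b\<^sup>2 + a * b\<close>. Its square is therefore constant, and since the step is invertible this
  holds in both directions from index \<open>0\<close>.
\<close>
lemma gen_fibonacci_cassini_sq:
  assumes "gen_fibonacci G"
  shows "((G k)\<^sup>2 - (G (k + 1))\<^sup>2 + G k * G (k + 1))\<^sup>2 = ((G 0)\<^sup>2 - (G 1)\<^sup>2 + G 0 * G 1)\<^sup>2"
proof -
  define Q where "Q k = (G k)\<^sup>2 - (G (k + 1))\<^sup>2 + G k * G (k + 1)" for k
  have step: "Q (k + 1) = - Q k" for k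
    using gen_fibonacci_rec[OF assms, of k]
    by (simp add: Q_def add.assoc power2_eq_square algebra_simps)
  have "(Q k)\<^sup>2 = (Q 0)\<^sup>2"
  proof (induction k rule: int_induct[where k = 0])
    case (step2 i)
    with step[of "i - 1"] show ?case by simp
  qed (simp_all add: step)
  then show ?thesis by (simp add: Q_def)
qed

text \<open>
  The sign convention for negative upper limits is exactly the one that makes telescoping
  valid for every integer \<open>n\<close>.
\<close>
lemma sum_from_1_telescope:
  assumes "\<And>j. a j = F j - F (j - 1)"
  shows "sum_from_1 a n = F n - F 0"
proof -
  have interval: "(\<Sum>j=m + 1..n. a j) = F n - F m" if "m \<le> n" for m n
    using that
  proof (induction n rule: int_ge_induct)
    case (step i)
    from step.hyps have "{m + 1..i + 1} = insert (i + 1) {m + 1..i}" by auto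
    with step.IH show ?case by (simp add: assms)
  qed simp
  show ?thesis
    using interval[of 0 n] interval[of n 0] by (auto simp: sum_from_1_def)
qed

theorem theorem3:
  fixes G :: "int \<Rightarrow> complex" and e :: complex and n t :: int
  assumes "gen_fibonacci G"
    and "e = (G 0)^2 - (G 1)^2 + G 0 * G 1"
  shows "sum_from_1 (\<lambda>j. G (j + t) ^ 6) n =
      (G (n + t) ^ 5 * G (n + t + 3) - G t ^ 5 * G (t + 3)) / 4
      + e^2 * (G (n + t) * (G (n + t + 1) + G (n + t - 1)) - G t * (G (t + 1) + G (t - 1))) / 4"
proof -
  define F where
    "F k = (G k ^ 5 * G (k + 3) + e\<^sup>2 * (G k * (G (k + 1) + G (k - 1)))) / 4" for k
  have step: "G k ^ 6 = F k - F (k - 1)" for k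
  proof -
    define a b where "a = G (k - 1)" and "b = G k"
    have rec: "G (i + 2) = G (i + 1) + G i" for i
      by (rule gen_fibonacci_rec[OF assms(1)])
    have prev2: "G (k - 2) = b - a"
      using rec[of "k - 2"] by (simp add: a_def b_def)
    have next1: "G (k + 1) = a + b"
      using rec[of "k - 1"] by (simp add: a_def b_def add.commute)
    have next2: "G (k + 2) = a + 2 * b"
      using rec[of k] next1 by (simp add: b_def)
    have next3: "G (k + 3) = 2 * a + 3 * b"
      using rec[of "k + 1"] next1 next2 by (simp add: add.assoc)
    have e_sq: "e\<^sup>2 = (a\<^sup>2 - b\<^sup>2 + a * b)\<^sup>2"
      using gen_fibonacci_cassini_sq[OF assms(1), of "k - 1"] assms(2)
      by (simp add: a_def b_def)
    have F_k: "4 * F k = b ^ 5 * (2 * a + 3 * b) + e\<^sup>2 * (b * (a + b + a))"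
      using next1 next3 by (simp add: F_def a_def b_def)
    have F_pred: "4 * F (k - 1) = a ^ 5 * (a + 2 * b) + e\<^sup>2 * (a * (b + (b - a)))"
      using next2 prev2 by (simp add: F_def a_def b_def add.commute)
    have "4 * b ^ 6 = 4 * F k - 4 * F (k - 1)"
      unfolding F_k F_pred e_sq by algebra
    then have "4 * b ^ 6 = 4 * (F k - F (k - 1))"
      by (simp only: right_diff_distrib)
    then have "b ^ 6 = F k - F (k - 1)"
      by (simp only: mult_cancel_left numeral_neq_zero simp_thms)
    then show ?thesis by (simp add: b_def)
  qed
  have "sum_from_1 (\<lambda>j. G (j + t) ^ 6) n = F (n + t) - F (0 + t)"
    by (rule sum_from_1_telescope[where F = "\<lambda>j. F (j + t)"])
       (simp add: step algebra_simps)
  then show ?thesis by (simp add: F_def field_simps)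
qed

end
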